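(* Let $n\in\mathbb{N}$, let $\mathbf{q}=(q_1,\ldots,q_n)\in(0,1)^n$, and let $X_1,\ldots,X_n$ be independent with $X_j\sim\mathrm{Geo}(q_j)$. Put $X_{n:n}=\max(X_1,\ldots,X_n)$. Then for every $r\in\mathbb{N}$, $$\psi_r(\mathbf{q})\le \mathbb{E}[X_{n:n}^r]\le \sum_{s=0}^{r}\binom{r}{s}\psi_s(\mathbf{q}),$$ where, for each integer $r\ge 0$, $$\psi_r(\mathbf{q})= r!\sum_{s=1}^{n}(-1)^{s+1}\sum_{A\subseteq\{1,\ldots,n\},\,|A|=s}\Bigl(\sum_{j\in A}\phi(q_j)\Bigr)^{-r},\qquad \phi(q)=-\log(1-q).$$
   Context: $\mathbb{N}=\{1,2,\ldots\}$; $\log$ is the natural logarithm. $\mathrm{Geo}(q)$ is the geometric distribution on $\{1,2,\ldots\}$ counting the number of independent Bernoulli($q$) trials up to and including the first success: $\mathbb{P}(X=k)=(1-q)^{k-1}q$. *)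

theory Defs
  imports "HOL-Probability.Probability"
begin

text \<open>
  The library's \<^const>\<open>geometric_pmf\<close> counts the failures before the first success and lives on
  \<open>{0, 1, \<dots>}\<close>; shifting it by one counts the trials up to and including the first success.
\<close>
definition geo :: "real \<Rightarrow> nat pmf" where
  "geo q = map_pmf Suc (geometric_pmf q)"

lemma pmf_geo:
  assumes "q \<in> {0<..1}" "k \<ge> 1"
  shows "pmf (geo q) k = (1 - q) ^ (k - 1) * q"
proof -
  from \<open>k \<ge> 1\<close> obtain m where "k = Suc m" by (cases k) auto
  then show ?thesis
    using assms by (simp add: geo_def pmf_map_inj')
qed

definition phi :: "real \<Rightarrow> real" where
  "phi q = - ln (1 - q)"

definition psi :: "nat \<Rightarrow> (nat \<Rightarrow> real) \<Rightarrow> nat \<Rightarrow> real" where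
  "psi n q r =
     fact r * (\<Sum>s = 1..n. (-1) ^ (s + 1) *
       (\<Sum>A | A \<subseteq> {1..n} \<and> card A = s. (\<Sum>j\<in>A. phi (q j)) powi (- int r)))"

end

theory Submission
  imports Defs
begin

text \<open>
  Let \<open>G t = 1 - (\<Prod>j. 1 - exp (- t * phi (q j)))\<close>. This is a decreasing function whose value at an
  integer \<open>k\<close> is the probability that the maximum exceeds \<open>k\<close>, so the \<open>r\<close>-th moment is
  \<open>\<Sum>k. ((k + 1)^r - k^r) * G k\<close>. Expanding the product shows that \<open>psi n q r\<close> is the integral of
  \<open>r * t^(r - 1) * G t\<close> over \<open>{0..}\<close> for \<open>r \<ge> 1\<close>, and \<open>psi n q 0 = 1\<close>. Comparing \<open>G t\<close> on
  \<open>{k..k + 1}\<close> with its values at the end points, for the weights \<open>r * t^(r - 1)\<close> and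
  \<open>r * (1 + t)^(r - 1)\<close> respectively, gives the two bounds. The integrals enter only through
  antiderivatives vanishing at infinity, whose increments telescope.
\<close>

section \<open>Gamma integrals as antiderivatives\<close>

lemma tendsto_power_mult_exp_neg:
  fixes l :: real
  assumes "l > 0"
  shows "((\<lambda>t. t ^ k * exp (- t * l)) \<longlongrightarrow> 0) at_top"
proof -
  have "filterlim (\<lambda>t. l * t) at_top at_top"
    using assms by (simp add: filterlim_tendsto_pos_mult_at_top[OF tendsto_const _ filterlim_ident])
  from filterlim_compose[OF tendsto_power_div_exp_0 this, of k]
  have "((\<lambda>t. inverse (l ^ k) * ((l * t) ^ k / exp (l * t))) \<longlongrightarrow> inverse (l ^ k) * 0) at_top"
    by (intro tendsto_mult tendsto_const)
  also have "(\<lambda>t. inverse (l ^ k) * ((l * t) ^ k / exp (l * t))) = (\<lambda>t. t ^ k * exp (- t * l))"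
    using assms by (auto simp: power_mult_distrib exp_minus field_simps)
  finally show ?thesis by simp
qed

text \<open>\<open>V t\<close> plays the role of minus the integral of the weight over
  \<open>{t..}\<close>, so \<open>- V 0\<close> is a Gamma integral. The induction on
  \<open>m\<close> is integration by parts.\<close>

lemma power_exp_antiderivative:
  fixes l :: real
  assumes "l > 0"
  shows "\<exists>V. (\<forall>t. (V has_real_derivative real (Suc m) * t ^ m * exp (- t * l)) (at t)) \<and>
             (V \<longlongrightarrow> 0) at_top \<and> V 0 = - fact (Suc m) / l ^ Suc m"
proof (induction m)
  case 0
  have "((\<lambda>t. - exp (- t * l) / l) has_real_derivative exp (- t * l)) (at t)" for t
    by (rule derivative_eq_intros refl | use assms in simp)+
  moreover have "((\<lambda>t. - exp (- t * l) / l) \<longlongrightarrow> 0) at_top"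
    using tendsto_mult[OF tendsto_const[of "- 1 / l"] tendsto_power_mult_exp_neg[OF assms, of 0]] by simp
  ultimately show ?case by (intro exI[of _ "\<lambda>t. - exp (- t * l) / l"]) simp
next
  case (Suc m)
  from Suc.IH obtain V
    where V: "\<forall>t. (V has_real_derivative real (Suc m) * t ^ m * exp (- t * l)) (at t)"
      "(V \<longlongrightarrow> 0) at_top" "V 0 = - fact (Suc m) / l ^ Suc m"
    by (elim exE conjE)
  \<comment> \<open>Integrating \<open>t ^ Suc m * exp (- t * l)\<close> by parts leaves the
    boundary term \<open>- t ^ Suc m * exp (- t * l) / l\<close> plus \<open>1 / l\<close> times the
    integral behind \<open>V\<close>; the factor \<open>m + 2\<close> is the normalisation
    \<open>real (Suc (Suc m))\<close>.\<close>
  define W where "W t = (real m + 2) * (V t / l - t ^ Suc m * exp (- t * l) / l)" for t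
  have "(W has_real_derivative real (Suc (Suc m)) * t ^ Suc m * exp (- t * l)) (at t)" for t
  proof -
    have "((\<lambda>t. t ^ Suc m) has_real_derivative real (Suc m) * t ^ m) (at t)"
      using DERIV_pow[of "Suc m" t] by simp
    moreover have "((\<lambda>t. exp (- t * l)) has_real_derivative - l * exp (- t * l)) (at t)"
      by (rule derivative_eq_intros refl | simp)+
    ultimately have "(W has_real_derivative (real m + 2) *
        (real (Suc m) * t ^ m * exp (- t * l) / l -
          (real (Suc m) * t ^ m * exp (- t * l) + (- l * exp (- t * l)) * t ^ Suc m) / l)) (at t)"
      unfolding W_def by (intro DERIV_cmult DERIV_diff DERIV_cdivide DERIV_mult V(1)[rule_format])
    also have "(real m + 2) * (real (Suc m) * t ^ m * exp (- t * l) / l -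
          (real (Suc m) * t ^ m * exp (- t * l) + (- l * exp (- t * l)) * t ^ Suc m) / l) =
        real (Suc (Suc m)) * t ^ Suc m * exp (- t * l)"
      using assms by (simp add: diff_divide_distrib add_divide_distrib del: power_Suc)
    finally show ?thesis .
  qed
  moreover have "(W \<longlongrightarrow> (real m + 2) * (0 / l - 0 / l)) at_top"
    unfolding W_def using assms by (intro tendsto_intros V(2) tendsto_power_mult_exp_neg) auto
  moreover have "W 0 = - fact (Suc (Suc m)) / l ^ Suc (Suc m)"
    by (simp add: W_def V(3) field_simps)
  ultimately show ?case by (intro exI[of _ W]) simp
qed

section \<open>Inclusion-exclusion and the function \<open>psi\<close>\<close>

text \<open>Expanding the product gives one term per subset of \<open>I\<close>; the empty subset
  contributes the 1 that cancels.\<close>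

lemma prod_one_minus_exp:
  fixes c :: "'i \<Rightarrow> real"
  assumes "finite I"
  shows "1 - (\<Prod>j\<in>I. 1 - exp (- t * c j)) =
         (\<Sum>A\<in>Pow I - {{}}. (-1) ^ (card A + 1) * exp (- t * sum c A))"
proof -
  have "(\<Prod>j\<in>I. 1 - exp (- t * c j)) = (\<Prod>j\<in>I. (- exp (- t * c j)) + 1)"
    by (simp add: algebra_simps)
  also have "\<dots> = (\<Sum>A\<in>Pow I. \<Prod>j\<in>A. - exp (- t * c j))"
    using assms by (subst prod_add) simp_all
  also have "\<dots> = (\<Sum>A\<in>Pow I. (-1) ^ card A * exp (- t * sum c A))"
    using assms
    by (intro sum.cong refl)
       (auto simp: prod_uminus sum_distrib_left exp_sum finite_subset simp flip: sum_negf)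
  also have "\<dots> = 1 + (\<Sum>A\<in>Pow I - {{}}. (-1) ^ card A * exp (- t * sum c A))"
    using assms by (subst sum.remove[of _ "{}"]) auto
  finally show ?thesis by (simp add: sum_negf)
qed

text \<open>Grouping the nonempty subsets by cardinality gives the defining double sum. The
  ungrouped form has the index set of the expanded product.\<close>

lemma psi_eq_sum_Pow:
  "psi n q r = fact r * (\<Sum>A\<in>Pow {1..n} - {{}}. (-1) ^ (card A + 1) * (\<Sum>j\<in>A. phi (q j)) powi (- int r))"
proof -
  have "(\<Sum>s = 1..n. \<Sum>A | A \<in> Pow {1..n} - {{}} \<and> card A = s.
            (-1) ^ (card A + 1) * (\<Sum>j\<in>A. phi (q j)) powi (- int r)) =
        (\<Sum>A\<in>Pow {1..n} - {{}}. (-1) ^ (card A + 1) * (\<Sum>j\<in>A. phi (q j)) powi (- int r))"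
  proof (rule sum.group)
    show "card ` (Pow {1..n} - {{}}) \<subseteq> {1..n}"
      using card_mono[of "{1..n}"] by (auto simp: Suc_le_eq card_gt_0_iff finite_subset)
  qed auto
  moreover have "(\<Sum>A | A \<in> Pow {1..n} - {{}} \<and> card A = s.
            (-1) ^ (card A + 1) * (\<Sum>j\<in>A. phi (q j)) powi (- int r)) =
        (-1) ^ (s + 1) * (\<Sum>A | A \<subseteq> {1..n} \<and> card A = s. (\<Sum>j\<in>A. phi (q j)) powi (- int r))"
    if "s \<in> {1..n}" for s
    unfolding sum_distrib_left by (rule sum.cong) (use that in auto)
  ultimately show ?thesis
    unfolding psi_def by simp
qed

text \<open>With all exponents zero, every factor of the product vanishes; as
  \<open>n \<ge> 1\<close>, the product is 0, and the alternating sum over nonempty subsets is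
  1.\<close>

lemma psi_0:
  assumes "n \<ge> 1"
  shows "psi n q 0 = 1"
  using prod_one_minus_exp[of "{1..n}" 0 "\<lambda>_. 0"] assms
  by (simp add: psi_eq_sum_Pow card_0_eq power_0_left)

section \<open>The tail function of the maximum\<close>

text \<open>This is the function \<open>G\<close> of the overview. For rates
  \<open>phi (q j) > 0\<close> and \<open>t \<ge> 0\<close> it is the survival function of the
  maximum of independent exponential variables with these rates.\<close>

definition max_tail :: "nat \<Rightarrow> (nat \<Rightarrow> real) \<Rightarrow> real \<Rightarrow> real" where
  "max_tail n q t = 1 - (\<Prod>j = 1..n. 1 - exp (- t * phi (q j)))"

lemma phi_pos:
  assumes "0 < x" "x < 1"
  shows "phi x > 0"
  using assms by (simp add: phi_def)

lemma max_tail_antimono: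
  assumes "\<And>j. j \<in> {1..n} \<Longrightarrow> 0 < q j \<and> q j < 1" "0 \<le> s" "s \<le> t"
  shows "max_tail n q t \<le> max_tail n q s"
  unfolding max_tail_def using assms
  by (auto intro!: prod_mono mult_right_mono mult_nonneg_nonneg less_imp_le[OF phi_pos])

lemma max_tail_nonneg:
  assumes "\<And>j. j \<in> {1..n} \<Longrightarrow> 0 < q j \<and> q j < 1" "0 \<le> t"
  shows "max_tail n q t \<ge> 0"
  unfolding max_tail_def using assms
  by (auto intro!: prod_le_1 mult_nonneg_nonneg less_imp_le[OF phi_pos])

text \<open>The signed sum of the antiderivatives for the single exponentials, one for each nonempty
  \<open>A\<close>; nonemptiness makes the rate positive. Their values at 0 add up to
  \<open>- psi n q (Suc m)\<close>.\<close>

lemma max_tail_antiderivative: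
  assumes q: "\<And>j. j \<in> {1..n} \<Longrightarrow> 0 < q j \<and> q j < 1"
  shows "\<exists>W. (\<forall>t. (W has_real_derivative real (Suc m) * t ^ m * max_tail n q t) (at t)) \<and>
             (W \<longlongrightarrow> 0) at_top \<and> W 0 = - psi n q (Suc m)"
proof -
  let ?P = "Pow {1..n} - {{}}" and ?l = "\<lambda>A. \<Sum>j\<in>A. phi (q j)"
  have "?l A > 0" if "A \<in> ?P" for A
    using that q by (intro sum_pos) (auto intro!: phi_pos intro: finite_subset)
  then have "\<forall>A\<in>?P. \<exists>V. (\<forall>t. (V has_real_derivative real (Suc m) * t ^ m * exp (- t * ?l A)) (at t)) \<and>
             (V \<longlongrightarrow> 0) at_top \<and> V 0 = - fact (Suc m) / ?l A ^ Suc m"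
    using power_exp_antiderivative by blast
  from bchoice[OF this] obtain V where V:
    "\<And>A t. A \<in> ?P \<Longrightarrow> (V A has_real_derivative real (Suc m) * t ^ m * exp (- t * ?l A)) (at t)"
    "\<And>A. A \<in> ?P \<Longrightarrow> (V A \<longlongrightarrow> 0) at_top"
    "\<And>A. A \<in> ?P \<Longrightarrow> V A 0 = - fact (Suc m) / ?l A ^ Suc m" by metis
  define W where "W t = (\<Sum>A\<in>?P. (-1) ^ (card A + 1) * V A t)" for t
  have "(W has_real_derivative (\<Sum>A\<in>?P. (-1) ^ (card A + 1) *
          (real (Suc m) * t ^ m * exp (- t * ?l A)))) (at t)" for t
    unfolding W_def by (intro DERIV_sum DERIV_cmult V(1))
  also have "(\<Sum>A\<in>?P. (-1) ^ (card A + 1) * (real (Suc m) * t ^ m * exp (- t * ?l A))) =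
          real (Suc m) * t ^ m * max_tail n q t" for t
    unfolding max_tail_def by (subst prod_one_minus_exp) (simp_all add: sum_distrib_left mult_ac)
  finally have "(W has_real_derivative real (Suc m) * t ^ m * max_tail n q t) (at t)" for t .
  moreover have "(W \<longlongrightarrow> (\<Sum>A\<in>?P. (-1) ^ (card A + 1) * 0)) at_top"
    unfolding W_def by (intro tendsto_intros V(2))
  moreover have "W 0 = - psi n q (Suc m)"
    unfolding W_def psi_eq_sum_Pow sum_distrib_left sum_negf[symmetric]
    by (intro sum.cong refl) (simp add: V(3) power_int_minus field_simps del: power_Suc fact_Suc of_nat_Suc)
  ultimately show ?thesis by (intro exI[of _ W]) simp
qed

section \<open>Comparing the tail series with the integrals\<close>

text \<open>Stands in for monotonicity of the integral over \<open>{a..b}\<close>: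
  \<open>g - f\<close> has a nonnegative derivative there.\<close>

lemma DERIV_le_imp_diff_le:
  fixes f g :: "real \<Rightarrow> real"
  assumes "a \<le> b"
    and "\<And>x. (f has_real_derivative f' x) (at x)" "\<And>x. (g has_real_derivative g' x) (at x)"
    and "\<And>x. a \<le> x \<Longrightarrow> x \<le> b \<Longrightarrow> f' x \<le> g' x"
  shows "f b - f a \<le> g b - g a"
proof -
  have "g a - f a \<le> g b - f b"
    by (rule DERIV_nonneg_imp_nondecreasing[of _ _ "\<lambda>x. g x - f x"])
       (use assms in \<open>auto intro!: exI[of _ "g' _ - f' _"] DERIV_diff\<close>)
  then show ?thesis by simp
qed

text \<open>Both sides are the derivative of \<open>(1 + t) ^ Suc m\<close>. It turns the binomial
  combination of the weights behind \<open>psi n q s\<close> into the single weight needed for the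
  upper bound.\<close>

lemma binomial_power_deriv:
  fixes t :: real
  shows "(\<Sum>s = 1..Suc m. real (Suc m choose s) * (real s * t ^ (s - 1))) = real (Suc m) * (1 + t) ^ m"
proof -
  have "(\<Sum>s = 1..Suc m. real (Suc m choose s) * (real s * t ^ (s - 1))) =
        (\<Sum>s\<le>m. real (Suc m choose Suc s) * (real (Suc s) * t ^ s))"
    by (rule sum.reindex_bij_witness[of _ Suc "\<lambda>s. s - 1"]) auto
  also have "\<dots> = (\<Sum>s\<le>m. real (Suc m) * (real (m choose s) * t ^ s))"
  proof (intro sum.cong refl)
    fix s
    have "real (Suc m choose Suc s) * real (Suc s) = real (Suc m) * real (m choose s)"
      by (metis Suc_times_binomial_eq mult.commute of_nat_mult)
    then show "real (Suc m choose Suc s) * (real (Suc s) * t ^ s) = real (Suc m) * (real (m choose s) * t ^ s)"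
      by (metis mult.assoc)
  qed
  also have "\<dots> = real (Suc m) * (t + 1) ^ m"
    by (subst binomial_ring) (simp add: sum_distrib_left)
  finally show ?thesis by (simp add: add.commute)
qed

lemma max_tail_sum_bounds:
  fixes n m :: nat and q :: "nat \<Rightarrow> real"
  assumes n: "n \<ge> 1" and q: "\<And>j. j \<in> {1..n} \<Longrightarrow> 0 < q j \<and> q j < 1"
  defines "a \<equiv> \<lambda>k. (real (Suc k) ^ Suc m - real k ^ Suc m) * max_tail n q (real k)"
  shows "summable a" and "psi n q (Suc m) \<le> suminf a"
    and "suminf a \<le> (\<Sum>s = 0..Suc m. real (Suc m choose s) * psi n q s)"
proof -
  have "\<forall>s. \<exists>W. (\<forall>t. (W has_real_derivative real (Suc s) * t ^ s * max_tail n q t) (at t)) \<and>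
             (W \<longlongrightarrow> 0) at_top \<and> W 0 = - psi n q (Suc s)"
    by (intro allI max_tail_antiderivative q)
  from choice[OF this] obtain W where W:
    "\<And>s t. (W s has_real_derivative real (Suc s) * t ^ s * max_tail n q t) (at t)"
    "\<And>s. (W s \<longlongrightarrow> 0) at_top" "\<And>s. W s 0 = - psi n q (Suc s)" by metis
  \<comment> \<open>On \<open>{k..k + 1}\<close> the tail is at most its value at \<open>k\<close>,
    and the weight \<open>real (Suc m) * t ^ m\<close> integrates to the coefficient in
    \<open>a k\<close>.\<close>
  have lower: "W m (real (Suc k)) - W m (real k) \<le> a k" for k
  proof -
    have "W m (real (Suc k)) - W m (real k) \<le>
          real (Suc k) ^ Suc m * max_tail n q (real k) - real k ^ Suc m * max_tail n q (real k)"
    proof (rule DERIV_le_imp_diff_le[OF _ W(1)])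
      show "((\<lambda>t. t ^ Suc m * max_tail n q (real k)) has_real_derivative
              real (Suc m) * t ^ m * max_tail n q (real k)) (at t)" for t
        by (rule derivative_eq_intros refl | simp)+
    qed (auto intro!: mult_left_mono max_tail_antimono q)
    then show ?thesis by (simp add: a_def algebra_simps)
  qed
  \<comment> \<open>The increments telescope to the limit 0 minus \<open>W m 0\<close>.\<close>
  have lower_sums: "(\<lambda>k. W m (real (Suc k)) - W m (real k)) sums psi n q (Suc m)"
    using telescope_sums[OF filterlim_compose[OF W(2) filterlim_real_sequentially], of m] W(3)[of m]
    by simp
  \<comment> \<open>The shift \<open>s - 1\<close> pairs each binomial coefficient with the
    antiderivative whose value at 0 is \<open>- psi n q s\<close>. The index \<open>s = 0\<close> is
    left out; the term \<open>a 0\<close> will supply it.\<close>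
  define Z where "Z t = (\<Sum>s = 1..Suc m. real (Suc m choose s) * W (s - 1) t)" for t
  have Z: "(Z has_real_derivative real (Suc m) * (1 + t) ^ m * max_tail n q t) (at t)" for t
  proof -
    have "(Z has_real_derivative (\<Sum>s = 1..Suc m. real (Suc m choose s) *
            (real (Suc (s - 1)) * t ^ (s - 1) * max_tail n q t))) (at t)"
      unfolding Z_def by (intro DERIV_sum DERIV_cmult W(1))
    also have "(\<Sum>s = 1..Suc m. real (Suc m choose s) *
            (real (Suc (s - 1)) * t ^ (s - 1) * max_tail n q t)) =
          (\<Sum>s = 1..Suc m. real (Suc m choose s) * (real s * t ^ (s - 1))) * max_tail n q t"
      unfolding sum_distrib_right by (intro sum.cong refl) (simp add: mult_ac)
    finally show ?thesis unfolding binomial_power_deriv .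
  qed
  \<comment> \<open>Here the tail is at least its value at \<open>k + 1\<close>. The weight with
    \<open>1 + t\<close> integrates over \<open>{k..k + 1}\<close> to the coefficient of
    \<open>a (Suc k)\<close>, not of \<open>a k\<close>, so the interval bounds the next term of the
    series.\<close>
  have upper: "a (Suc k) \<le> Z (real (Suc k)) - Z (real k)" for k
  proof -
    have "(1 + real (Suc k)) ^ Suc m * max_tail n q (real (Suc k)) -
            (1 + real k) ^ Suc m * max_tail n q (real (Suc k)) \<le> Z (real (Suc k)) - Z (real k)"
    proof (rule DERIV_le_imp_diff_le[OF _ _ Z])
      show "((\<lambda>t. (1 + t) ^ Suc m * max_tail n q (real (Suc k))) has_real_derivative
              real (Suc m) * (1 + t) ^ m * max_tail n q (real (Suc k))) (at t)" for t
        by (rule derivative_eq_intros refl | simp)+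
    qed (auto intro!: mult_left_mono max_tail_antimono q)
    then show ?thesis by (simp add: a_def algebra_simps)
  qed
  have "(Z \<longlongrightarrow> (\<Sum>s = 1..Suc m. real (Suc m choose s) * 0)) at_top"
    unfolding Z_def by (intro tendsto_intros W(2))
  then have "(Z \<longlongrightarrow> 0) at_top" by simp
  from telescope_sums[OF filterlim_compose[OF this filterlim_real_sequentially]]
  have "(\<lambda>k. Z (real (Suc k)) - Z (real k)) sums - Z 0" by simp
  also have "- Z 0 = (\<Sum>s = 1..Suc m. real (Suc m choose s) * psi n q s)"
    unfolding Z_def sum_negf[symmetric] by (intro sum.cong refl) (simp add: W(3))
  finally have upper_sums: "(\<lambda>k. Z (real (Suc k)) - Z (real k)) sums
      (\<Sum>s = 1..Suc m. real (Suc m choose s) * psi n q s)" .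
  have nonneg: "a k \<ge> 0" for k
    unfolding a_def by (intro mult_nonneg_nonneg max_tail_nonneg q) (simp_all add: power_mono del: power_Suc)
  have summable_Suc: "summable (\<lambda>k. a (Suc k))"
    by (rule summable_comparison_test'[OF sums_summable[OF upper_sums], of 0])
       (use upper nonneg in simp)
  then show "summable a" by (subst (asm) summable_Suc_iff)
  then show "psi n q (Suc m) \<le> suminf a"
    using suminf_le[OF lower sums_summable[OF lower_sums]] sums_unique[OF lower_sums] by simp
  \<comment> \<open>At 0 all factors \<open>1 - exp 0\<close> vanish, so the tail is 1. This first
    term equals \<open>psi n q 0\<close>, the missing \<open>s = 0\<close> summand.\<close>
  have "a 0 = 1"
    using n by (simp add: a_def max_tail_def power_0_left)
  then have "suminf a = 1 + (\<Sum>k. a (Suc k))"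
    using suminf_split_head[OF \<open>summable a\<close>] by simp
  also have "(\<Sum>k. a (Suc k)) \<le> (\<Sum>s = 1..Suc m. real (Suc m choose s) * psi n q s)"
    using suminf_le[OF upper summable_Suc sums_summable[OF upper_sums]] sums_unique[OF upper_sums]
    by simp
  also have "1 + (\<Sum>s = 1..Suc m. real (Suc m choose s) * psi n q s) =
        (\<Sum>s = 0..Suc m. real (Suc m choose s) * psi n q s)"
    using psi_0[OF n] by (subst (2) sum.atLeast_Suc_atMost) simp_all
  finally show "suminf a \<le> (\<Sum>s = 0..Suc m. real (Suc m choose s) * psi n q s)" by simp
qed

section \<open>Geometric tails and moments\<close>

lemma measure_geo_atMost:
  assumes "0 < p" "p < 1"
  shows "measure (measure_pmf (geo p)) {..k} = 1 - (1 - p) ^ k"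
proof -
  \<comment> \<open>The shift by \<open>Suc\<close> pulls \<open>{..k}\<close> back to
    \<open>{..<k}\<close>, which is empty for \<open>k = 0\<close>.\<close>
  have "measure (measure_pmf (geo p)) {..k} = measure (measure_pmf (geometric_pmf p)) {..<k}"
    unfolding geo_def measure_map_pmf by (rule arg_cong[of _ _ "measure _"]) auto
  also have "\<dots> = (\<Sum>i<k. (1 - p) ^ i * p)"
    using assms by (simp add: measure_measure_pmf_finite)
  also have "\<dots> = 1 - (1 - p) ^ k"
    using assms by (induction k) (simp_all add: algebra_simps)
  finally show ?thesis .
qed

text \<open>Layer-cake argument: the power telescopes into its increments over
  \<open>k < Y \<omega>\<close>, and sum and integral are exchanged. Working in
  \<open>ennreal\<close> presupposes no integrability.\<close>

lemma (in prob_space) nn_integral_nat_power_eq_tail_sum: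
  fixes Y :: "'a \<Rightarrow> nat"
  assumes [measurable]: "Y \<in> measurable M (count_space UNIV)"
  shows "(\<integral>\<^sup>+\<omega>. ennreal (real (Y \<omega>) ^ Suc m) \<partial>M) =
         (\<Sum>k. ennreal ((real (Suc k) ^ Suc m - real k ^ Suc m) * prob {\<omega> \<in> space M. k < Y \<omega>}))"
proof -
  let ?w = "\<lambda>k. real (Suc k) ^ Suc m - real k ^ Suc m"
  have w: "?w k \<ge> 0" for k by (simp add: power_mono del: power_Suc)
  have "ennreal (real (Y \<omega>) ^ Suc m) = (\<Sum>k. ennreal (?w k) * indicator {\<omega> \<in> space M. k < Y \<omega>} \<omega>)"
    if "\<omega> \<in> space M" for \<omega>
  proof -
    have "(\<Sum>k. ennreal (?w k) * indicator {\<omega> \<in> space M. k < Y \<omega>} \<omega>) =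
          (\<Sum>k<Y \<omega>. ennreal (?w k) * indicator {\<omega> \<in> space M. k < Y \<omega>} \<omega>)"
      by (rule suminf_finite) auto
    also have "\<dots> = (\<Sum>k<Y \<omega>. ennreal (?w k))"
      using that by (intro sum.cong) auto
    also have "\<dots> = ennreal (\<Sum>k<Y \<omega>. ?w k)"
      by (rule sum_ennreal) (rule w)
    also have "(\<Sum>k<Y \<omega>. ?w k) = real (Y \<omega>) ^ Suc m"
      using sum_lessThan_telescope[of "\<lambda>k. real k ^ Suc m" "Y \<omega>"] by simp
    finally show ?thesis ..
  qed
  then have "(\<integral>\<^sup>+\<omega>. ennreal (real (Y \<omega>) ^ Suc m) \<partial>M) =
        (\<integral>\<^sup>+\<omega>. (\<Sum>k. ennreal (?w k) * indicator {\<omega> \<in> space M. k < Y \<omega>} \<omega>) \<partial>M)"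
    by (intro nn_integral_cong)
  also have "\<dots> = (\<Sum>k. \<integral>\<^sup>+\<omega>. ennreal (?w k) * indicator {\<omega> \<in> space M. k < Y \<omega>} \<omega> \<partial>M)"
    by (rule nn_integral_suminf) measurable
  also have "\<dots> = (\<Sum>k. ennreal (?w k * prob {\<omega> \<in> space M. k < Y \<omega>}))"
    by (intro suminf_cong, subst nn_integral_cmult_indicator)
       (auto simp: emeasure_eq_measure ennreal_mult[OF w] simp del: power_Suc of_nat_Suc)
  finally show ?thesis .
qed

theorem proposition3:
  fixes M :: "'a measure" and X :: "nat \<Rightarrow> 'a \<Rightarrow> nat"
    and q :: "nat \<Rightarrow> real" and n r :: nat
  assumes "prob_space M"
    and "n \<ge> 1" and "r \<ge> 1"
    and "\<And>j. j \<in> {1..n} \<Longrightarrow> 0 < q j \<and> q j < 1"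
    and "prob_space.indep_vars M (\<lambda>_. count_space UNIV) X {1..n}"
    and "\<And>j. j \<in> {1..n} \<Longrightarrow> distr M (count_space UNIV) (X j) = measure_pmf (geo (q j))"
  shows "integrable M (\<lambda>\<omega>. real (MAX j\<in>{1..n}. X j \<omega>) ^ r)
    \<and> psi n q r \<le> prob_space.expectation M (\<lambda>\<omega>. real (MAX j\<in>{1..n}. X j \<omega>) ^ r)
    \<and> prob_space.expectation M (\<lambda>\<omega>. real (MAX j\<in>{1..n}. X j \<omega>) ^ r)
        \<le> (\<Sum>s = 0..r. real (r choose s) * psi n q s)"
proof -
  interpret prob_space M by fact
  from \<open>r \<ge> 1\<close> obtain m where r: "r = Suc m" by (cases r) auto
  note q = assms(4)
  let ?Y = "\<lambda>\<omega>. MAX j\<in>{1..n}. X j \<omega>"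
  have X [measurable]: "X j \<in> measurable M (count_space UNIV)" if "j \<in> {1..n}" for j
    using assms(5) that by (auto simp: indep_vars_def)
  have le_iff: "?Y \<omega> \<le> k \<longleftrightarrow> (\<forall>j\<in>{1..n}. X j \<omega> \<le> k)" for \<omega> k
    using \<open>n \<ge> 1\<close> by (subst Max_le_iff) auto
  have Y [measurable]: "?Y \<in> measurable M (count_space UNIV)"
  proof (subst measurable_count_space_eq2_countable, safe)
    fix k :: nat
    have le_meas: "?Y -` {..i} \<inter> space M \<in> events" for i
    proof -
      have "?Y -` {..i} \<inter> space M = {\<omega> \<in> space M. \<forall>j\<in>{1..n}. X j \<omega> \<le> i}"
        by (auto simp: le_iff simp del: One_nat_def)
      also have "\<dots> \<in> events" by measurable
      finally show ?thesis .
    qed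
    \<comment> \<open>Sublevel sets of the maximum are finite intersections of events, and a level
      set is a difference of two of them. The case \<open>k = 0\<close> is separate because
      \<open>0 - 1 = 0\<close> would subtract the whole set.\<close>
    have "?Y -` {k} \<inter> space M = (?Y -` {..k} \<inter> space M) - (if k = 0 then {} else ?Y -` {..k - 1} \<inter> space M)"
      by auto
    then show "?Y -` {k} \<inter> space M \<in> events" using le_meas[of k] le_meas[of "k - 1"] by (cases "k = 0") simp_all
  qed simp_all
  \<comment> \<open>Independence factorises the event that all \<open>X j\<close> are at most
    \<open>k\<close>, and \<open>phi\<close> is chosen so that \<open>(1 - q j) ^ k\<close> is an
    exponential in \<open>k\<close>.\<close>
  have tail: "prob {\<omega> \<in> space M. k < ?Y \<omega>} = max_tail n q (real k)" for k
  proof -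
    have "prob {\<omega> \<in> space M. ?Y \<omega> \<le> k} = prob (\<Inter>j\<in>{1..n}. X j -` {..k} \<inter> space M)"
      using \<open>n \<ge> 1\<close> by (intro arg_cong[of _ _ prob]) (auto simp: le_iff simp del: One_nat_def)
    also have "\<dots> = (\<Prod>j = 1..n. prob (X j -` {..k} \<inter> space M))"
      using assms(5) \<open>n \<ge> 1\<close> by (intro indep_varsD_finite) auto
    also have "\<dots> = (\<Prod>j = 1..n. 1 - exp (- real k * phi (q j)))"
    proof (intro prod.cong refl)
      fix j assume j: "j \<in> {1..n}"
      have "prob (X j -` {..k} \<inter> space M) = measure (measure_pmf (geo (q j))) {..k}"
        using measure_distr[OF X[OF j], of "{..k}"] assms(6)[OF j] by simp
      also have "\<dots> = 1 - (1 - q j) ^ k"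
        using q[OF j] by (simp add: measure_geo_atMost)
      also have "(1 - q j) ^ k = exp (- real k * phi (q j))"
        using q[OF j] by (simp add: phi_def exp_of_nat_mult)
      finally show "prob (X j -` {..k} \<inter> space M) = 1 - exp (- real k * phi (q j))" .
    qed
    finally have "prob {\<omega> \<in> space M. ?Y \<omega> \<le> k} = 1 - max_tail n q (real k)"
      by (simp add: max_tail_def)
    moreover have "prob {\<omega> \<in> space M. \<not> ?Y \<omega> \<le> k} = 1 - prob {\<omega> \<in> space M. ?Y \<omega> \<le> k}"
      by (rule prob_neg) measurable
    ultimately show ?thesis by (simp add: not_le)
  qed
  define a where "a k = (real (Suc k) ^ Suc m - real k ^ Suc m) * max_tail n q (real k)" for k
  have a: "summable a" "psi n q r \<le> suminf a"
      "suminf a \<le> (\<Sum>s = 0..r. real (r choose s) * psi n q s)"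
    unfolding a_def r by (intro max_tail_sum_bounds assms(2) q; assumption)+
  have nonneg: "a k \<ge> 0" for k
    unfolding a_def by (intro mult_nonneg_nonneg max_tail_nonneg q) (simp_all add: power_mono del: power_Suc)
  have "(\<integral>\<^sup>+\<omega>. ennreal (real (?Y \<omega>) ^ r) \<partial>M) = (\<Sum>k. ennreal (a k))"
    unfolding r nn_integral_nat_power_eq_tail_sum[OF Y] tail a_def ..
  also have "\<dots> = ennreal (suminf a)"
    by (rule suminf_ennreal2[OF nonneg a(1)])
  finally have moment: "(\<integral>\<^sup>+\<omega>. ennreal (real (?Y \<omega>) ^ r) \<partial>M) = ennreal (suminf a)" .
  \<comment> \<open>Summability of \<open>a\<close> makes the nonnegative integral finite, which
    yields integrability and the value of the expectation at once.\<close>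
  have "has_bochner_integral M (\<lambda>\<omega>. real (?Y \<omega>) ^ r) (suminf a)"
  proof (rule has_bochner_integral_nn_integral[OF _ _ _ moment])
    show "(\<lambda>\<omega>. real (?Y \<omega>) ^ r) \<in> borel_measurable M"
      using measurable_compose[OF Y, of "\<lambda>y. real y ^ r" borel] by simp
  qed (auto intro: suminf_nonneg[OF a(1) nonneg])
  then show ?thesis
    using a(2,3) by (simp add: has_bochner_integral_iff)
qed

end
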